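(* Let $n\ge 1$, let $0<\rho<1$ be real and let $\beta\ge 1$ be an integer. If algorithm OF-RRW is executed by $n$ stations on a multiple access channel without jamming and without collision detection, against any leaky-bucket adversary of type $(\rho,\beta)$, then in every round the total number of packets queued in the stations is at most $$\frac{2\rho}{1-\rho}\cdot n+\beta$$ and packet latency is at most $$\frac{2}{1-\rho}\cdot n+\beta(1+\rho).$$
   Context: Channel. There are $n$ stations with distinct names $0,1,\dots,n-1$ attached to a shared channel; $n$ and own names are known to the stations. Time is divided into synchronous rounds numbered from $0$; all stations start in round $0$ with empty queues. In each round each station either transmits one message (containing at most one packet) or pauses. A message is heard (by all stations) in a round iff it is the only message transmitted in that round. A round is void if no message is heard, silent if nobody transmits; without collision detection stations cannot tell silence from collision. All stations get the same feedback. Within a round the order is: transmissions, feedback, injection of new packets (enqueued into private unbounded FIFO queues), local state change. A packet is removed from its queue once heard, and never dropped before. Adversary of type $(\rho,\beta)$: in each contiguous segment of $t>0$ rounds it injects at most $\rho t+\beta$ packets, into arbitrary stations. Packet latency: an upper bound on the number of rounds a packet spends waiting, counted from the round of injection through the round in which it is heard, over all executions against such adversaries. Algorithm OF-RRW (Old-First-Round-Robin-Withholding): a conceptual token visits the stations in the cyclic order $0,1,\dots,n-1,0,\dots$, starting at station $0$ in round $0$. A phase is one full cycle of the token through all the stations. In a given phase, packets injected during the previous phase are old, and packets injected during the current phase are new; in the first phase there are no old packets. The station holding the token transmits its old packets, one per round, until it has none left (new packets stay in the queue); then it pauses, producing one silent round, which makes the token move to the next station. Stations without the token do not transmit. When a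 new phase begins, the new packets become old. *)

theory Defs
  imports Complex_Main
begin

text \<open>
  A packet is identified by the round and the station of its injection together with its
  position among the packets injected into that station in that round.
\<close>

datatype packet = Packet (inj_round: nat) (inj_station: nat) (inj_index: nat)

text \<open>
  An adversary's behaviour is given by \<open>adv r i\<close>, the number of packets it injects into
  station \<open>i\<close> in round \<open>r\<close>. Only the stations \<open>i < n\<close> exist.
\<close>

type_synonym injection = "nat \<Rightarrow> nat \<Rightarrow> nat"

definition leaky_bucket :: "nat \<Rightarrow> real \<Rightarrow> nat \<Rightarrow> injection \<Rightarrow> bool" where
  "leaky_bucket n \<rho> \<beta> adv \<longleftrightarrow>
     (\<forall>s t. t > 0 \<longrightarrow> real (\<Sum>r = s..<s + t. \<Sum>i<n. adv r i) \<le> \<rho> * real t + real \<beta>)"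

definition arrivals :: "injection \<Rightarrow> nat \<Rightarrow> nat \<Rightarrow> packet list" where
  "arrivals adv r i = map (Packet r i) [0..<adv r i]"

definition injected :: "nat \<Rightarrow> injection \<Rightarrow> packet set" where
  "injected n adv = (\<Union>r. \<Union>i<n. set (arrivals adv r i))"

text \<open>
  Channel without jamming and without collision detection: \<open>msg i\<close> is what station \<open>i\<close>
  transmits (\<open>None\<close> if it pauses). The result is the message heard, or \<open>None\<close> in a void
  round, whether the round is silent or has a collision.
\<close>

definition feedback :: "nat \<Rightarrow> (nat \<Rightarrow> 'm option) \<Rightarrow> 'm option" where
  "feedback n msg =
     (if \<exists>!i. i < n \<and> msg i \<noteq> None then msg (THE i. i < n \<and> msg i \<noteq> None) else None)"

text \<open>
  The private state of a station running OF-RRW: its own record of the token position, and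
  its FIFO queue, split into the packets that are old and those that are new in the current
  phase. The algorithm attaches no control information, so a message is just a packet.
\<close>

record station =
  token :: nat
  old :: "packet list"
  new :: "packet list"

definition queue :: "station \<Rightarrow> packet list" where
  "queue s = old s @ new s"

definition transmit :: "nat \<Rightarrow> station \<Rightarrow> packet option" where
  "transmit i s = (if token s = i \<and> old s \<noteq> [] then Some (hd (old s)) else None)"

definition dequeue :: "nat \<Rightarrow> packet option \<Rightarrow> station \<Rightarrow> station" where
  "dequeue i fb s = (if fb \<noteq> None \<and> fb = transmit i s then s\<lparr>old := tl (old s)\<rparr> else s)"

definition enqueue :: "packet list \<Rightarrow> station \<Rightarrow> station" where
  "enqueue ps s = s\<lparr>new := new s @ ps\<rparr>"

text \<open>
  A void round moves the token; a new phase begins when the token returns to station 0.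
  Packets injected in the last round of a phase thus belong to that phase.
\<close>

definition advance :: "nat \<Rightarrow> packet option \<Rightarrow> station \<Rightarrow> station" where
  "advance n fb s =
     (if fb \<noteq> None then s
      else let k = (token s + 1) mod n in
        if k = 0 then \<lparr>token = 0, old = old s @ new s, new = []\<rparr>
        else s\<lparr>token := k\<rparr>)"

text \<open>\<open>config n adv t i\<close> is the state of station \<open>i\<close> at the beginning of round \<open>t\<close>.\<close>

primrec config :: "nat \<Rightarrow> injection \<Rightarrow> nat \<Rightarrow> nat \<Rightarrow> station" where
  "config n adv 0 = (\<lambda>i. \<lparr>token = 0, old = [], new = []\<rparr>)"
| "config n adv (Suc t) =
     (let fb = feedback n (\<lambda>i. transmit i (config n adv t i))
      in (\<lambda>i. advance n fb (enqueue (arrivals adv t i) (dequeue i fb (config n adv t i)))))"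

definition heard :: "nat \<Rightarrow> injection \<Rightarrow> nat \<Rightarrow> packet option" where
  "heard n adv t = feedback n (\<lambda>i. transmit i (config n adv t i))"

definition total_queued :: "nat \<Rightarrow> injection \<Rightarrow> nat \<Rightarrow> nat" where
  "total_queued n adv t = (\<Sum>i<n. length (queue (config n adv t i)))"

text \<open>
  Waiting time counts both the round of injection and the round in which the packet is heard;
  in particular a finite bound requires every injected packet to be heard eventually.
\<close>

definition packet_latency_at_most :: "nat \<Rightarrow> injection \<Rightarrow> real \<Rightarrow> bool" where
  "packet_latency_at_most n adv L \<longleftrightarrow>
     (\<forall>p \<in> injected n adv. \<exists>t \<ge> inj_round p.
        heard n adv t = Some p \<and> real (t - inj_round p + 1) \<le> L)"

end

theory Submission
  imports Defs
begin

text \<open>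
  Let phase \<open>k\<close> start in round \<open>S\<^sub>k\<close> with \<open>O\<^sub>k\<close> old packets. It lasts \<open>n + O\<^sub>k\<close> rounds, and
  \<open>O\<^bsub>k+1\<^esub>\<close> is the number of packets injected during it. With \<open>x = \<rho>n/(1-\<rho>)\<close>, the fixed
  point of \<open>x = \<rho>(n+x)\<close>, the invariant is that for every \<open>t \<ge> S\<^sub>k\<close> the number \<open>O\<^sub>k\<close> plus the
  number of packets injected in the rounds \<open>S\<^sub>k,\<dots>,t-1\<close> is at most \<open>x + \<beta> + \<rho>(t-S\<^sub>k)\<close>.
  It is passed on to the next phase by itself if \<open>O\<^sub>k \<ge> x\<close>, and by the leaky-bucket bound from
  \<open>S\<^sub>k\<close> on if \<open>O\<^sub>k \<le> x\<close>; hence the burst \<open>\<beta>\<close> is paid only once. A packet injected in phase \<open>k\<close>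
  is heard by the end of phase \<open>k+1\<close>, so its latency is at most \<open>2n + O\<^sub>k + O\<^bsub>k+1\<^esub>\<close>.
\<close>

definition injections :: "nat \<Rightarrow> injection \<Rightarrow> nat \<Rightarrow> nat \<Rightarrow> nat" where
  "injections n adv s t = (\<Sum>r = s..<t. \<Sum>i<n. adv r i)"

definition old_count :: "nat \<Rightarrow> injection \<Rightarrow> nat \<Rightarrow> nat" where
  "old_count n adv t = (\<Sum>i<n. length (old (config n adv t i)))"

definition new_count :: "nat \<Rightarrow> injection \<Rightarrow> nat \<Rightarrow> nat" where
  "new_count n adv t = (\<Sum>i<n. length (new (config n adv t i)))"

definition holder :: "nat \<Rightarrow> injection \<Rightarrow> nat \<Rightarrow> nat" where
  "holder n adv t = token (config n adv t 0)"

text \<open>Token position 0 alone does not suffice, since station 0 keeps the token while it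
  transmits. The predicate may also hold later in station 0's turn as long as nothing has been
  injected; such a round serves equally well as the origin of a phase.\<close>

definition phase_start :: "nat \<Rightarrow> injection \<Rightarrow> nat \<Rightarrow> bool" where
  "phase_start n adv t \<longleftrightarrow> holder n adv t = 0 \<and> (\<forall>i<n. new (config n adv t i) = [])"

text \<open>The starting rounds are prescribed by recursion; that the execution really begins a
  phase in each of them is \<open>phase_start_phase\<close>.\<close>

primrec phase :: "nat \<Rightarrow> injection \<Rightarrow> nat \<Rightarrow> nat" where
  "phase n adv 0 = 0"
| "phase n adv (Suc k) = phase n adv k + n + old_count n adv (phase n adv k)"

lemma injections_Suc: "s \<le> t \<Longrightarrow> injections n adv s (Suc t) = injections n adv s t + (\<Sum>i<n. adv t i)"
  by (simp add: injections_def)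

lemma injections_split:
  "s \<le> t \<Longrightarrow> t \<le> u \<Longrightarrow> injections n adv s u = injections n adv s t + injections n adv t u"
  by (simp add: injections_def sum.atLeastLessThan_concat)

text \<open>Adds the empty segment \<open>s = t\<close>, which \<open>leaky_bucket\<close> leaves
  out, so that the invariant can be stated from the first round of a phase on.\<close>

lemma leaky_bucketD:
  assumes "leaky_bucket n \<rho> \<beta> adv" "s \<le> t"
  shows "real (injections n adv s t) \<le> \<rho> * real (t - s) + real \<beta>"
proof (cases "s = t")
  case False
  then have "t - s > 0" "s + (t - s) = t" using assms by auto
  then show ?thesis
    using assms(1) unfolding leaky_bucket_def injections_def by metis
qed (simp add: injections_def)

lemma total_queued_eq: "total_queued n adv t = old_count n adv t + new_count n adv t"
  by (simp add: total_queued_def old_count_def new_count_def queue_def sum.distrib)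

subsection \<open>Single rounds\<close>

text \<open>All stations receive the same feedback and update the token from it alone, so their
  private records agree and \<open>holder\<close> may read that of station 0.\<close>

lemma token_config: "token (config n adv t i) = holder n adv t"
  unfolding holder_def
proof (induction t arbitrary: i)
  case (Suc t)
  have "token (config n adv t i) = token (config n adv t 0)" by (rule Suc)
  then show ?case
    by (simp add: Let_def advance_def enqueue_def dequeue_def)
qed simp

lemma holder_less: "n \<ge> 1 \<Longrightarrow> holder n adv t < n"
  unfolding holder_def
  by (induction t) (auto simp: Let_def advance_def enqueue_def dequeue_def)

text \<open>Only the holder can transmit, so there are no collisions and every void round is
  silent.\<close>

lemma heard_eq:
  assumes "n \<ge> 1"
  shows "heard n adv t =
    (let q = old (config n adv t (holder n adv t)) in if q = [] then None else Some (hd q))"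
proof -
  let ?h = "holder n adv t"
  let ?m = "\<lambda>i. transmit i (config n adv t i)"
  have m: "?m i = (if i = ?h \<and> old (config n adv t ?h) \<noteq> []
                   then Some (hd (old (config n adv t ?h))) else None)" for i
    by (auto simp: transmit_def token_config)
  show ?thesis
  proof (cases "old (config n adv t ?h) = []")
    case True
    then show ?thesis by (simp add: heard_def feedback_def m)
  next
    case False
    then have u: "i < n \<and> ?m i \<noteq> None \<longleftrightarrow> i = ?h" for i
      using holder_less[OF assms, of adv t] by (auto simp: m)
    show ?thesis using False unfolding heard_def feedback_def u by (simp add: m)
  qed
qed

lemma config_Suc_heard:
  assumes "n \<ge> 1" "old (config n adv t (holder n adv t)) \<noteq> []"
  shows "config n adv (Suc t) i = (config n adv t i)
    \<lparr>old := (if i = holder n adv t then tl else id) (old (config n adv t i)),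
     new := new (config n adv t i) @ arrivals adv t i\<rparr>"
  using heard_eq[OF assms(1), of adv t] assms(2) unfolding heard_def
  by (simp add: Let_def advance_def enqueue_def dequeue_def transmit_def token_config)

lemma config_Suc_void:
  assumes "n \<ge> 1" "old (config n adv t (holder n adv t)) = []"
  shows "config n adv (Suc t) i =
    (if Suc (holder n adv t) < n
     then (config n adv t i)
       \<lparr>token := Suc (holder n adv t), new := new (config n adv t i) @ arrivals adv t i\<rparr>
     else \<lparr>token = 0, old = old (config n adv t i) @ new (config n adv t i) @ arrivals adv t i,
           new = []\<rparr>)"
proof -
  have "Suc (holder n adv t) mod n = (if Suc (holder n adv t) < n then Suc (holder n adv t) else 0)"
    using holder_less[OF assms(1), of adv t] by (simp add: mod_Suc)
  then show ?thesis
    using heard_eq[OF assms(1), of adv t] assms(2) unfolding heard_def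
    by (simp add: Let_def advance_def enqueue_def dequeue_def token_config)
qed

text \<open>The only removal is the \<open>tl\<close> applied to the holder's old packets, and the
  head it drops is the message heard.\<close>

lemma leaves_queue_imp_heard:
  assumes "n \<ge> 1" "p \<in> set (queue (config n adv t i))" "p \<notin> set (queue (config n adv (Suc t) i))"
  shows "heard n adv t = Some p"
proof (cases "old (config n adv t (holder n adv t)) = []")
  case True
  then show ?thesis
    using assms by (auto simp: queue_def config_Suc_void simp del: config.simps split: if_splits)
next
  case False
  show ?thesis
  proof (cases "i = holder n adv t")
    case True
    then show ?thesis
      using assms False
      by (cases "old (config n adv t i)")
        (auto simp: queue_def config_Suc_heard heard_eq simp del: config.simps)
  next
    case not_holder: False
    then show ?thesis
      using assms False by (auto simp: queue_def config_Suc_heard simp del: config.simps)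
  qed
qed

lemma arrivals_subset_queue:
  assumes "n \<ge> 1"
  shows "set (arrivals adv t i) \<subseteq> set (queue (config n adv (Suc t) i))"
  using assms
  by (cases "old (config n adv t (holder n adv t)) = []")
    (auto simp: queue_def config_Suc_void config_Suc_heard simp del: config.simps)

lemma new_count_Suc:
  assumes "\<And>i. i < n \<Longrightarrow> new (config n adv (Suc t) i) = new (config n adv t i) @ arrivals adv t i"
  shows "new_count n adv (Suc t) = new_count n adv t + (\<Sum>i<n. adv t i)"
proof -
  have "new_count n adv (Suc t) = (\<Sum>i<n. length (new (config n adv t i)) + adv t i)"
    unfolding new_count_def by (rule sum.cong) (auto simp: assms arrivals_def simp del: config.simps)
  then show ?thesis by (simp add: new_count_def sum.distrib)
qed

subsection \<open>A single phase\<close>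

text \<open>Each round either removes one old packet or moves the token one station on. So
  \<open>d\<close> is the number of packets heard plus the token position, which is the first
  conjunct. The bound on \<open>d\<close> keeps the token from returning to station 0.\<close>

lemma within_phase:
  assumes n: "n \<ge> 1" and s: "phase_start n adv s" and d: "d < n + old_count n adv s"
  shows "d + old_count n adv (s + d) = old_count n adv s + holder n adv (s + d)
    \<and> holder n adv (s + d) \<le> d
    \<and> (\<forall>i < holder n adv (s + d). old (config n adv (s + d) i) = [])
    \<and> new_count n adv (s + d) = injections n adv s (s + d)
    \<and> (\<forall>i<n. \<forall>p \<in> set (new (config n adv (s + d) i)). s \<le> inj_round p)"
  using d
proof (induction d)
  case 0
  then show ?case using s by (simp add: phase_start_def new_count_def injections_def)
next
  case (Suc d)
  let ?t = "s + d" and ?h = "holder n adv (s + d)"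
  from Suc have count: "d + old_count n adv ?t = old_count n adv s + ?h"
    and voids: "?h \<le> d"
    and served: "\<forall>i < ?h. old (config n adv ?t i) = []"
    and new_count: "new_count n adv ?t = injections n adv s ?t"
    and new: "\<forall>i<n. \<forall>p \<in> set (new (config n adv ?t i)). s \<le> inj_round p"
    by auto
  have h: "?h < n" using holder_less[OF n] .
  have arr: "s \<le> inj_round p" if "p \<in> set (arrivals adv ?t i)" for p i
    using that by (auto simp: arrivals_def)
  show ?case
  proof (cases "old (config n adv ?t ?h) = []")
    case True
    \<comment> \<open>If the last station fell silent here, no old packets would be left and
      \<open>count\<close> would give \<open>d = old_count n adv s + n - 1\<close>, contradicting
      the bound on \<open>Suc d\<close>.\<close>
    have "Suc ?h < n"
    proof (rule ccontr)
      assume "\<not> Suc ?h < n"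
      then have "Suc ?h = n" using h by simp
      then have "old (config n adv ?t i) = []" if "i < n" for i
        using that served True by (metis less_Suc_eq)
      then have "old_count n adv ?t = 0" by (simp add: old_count_def)
      then show False using count Suc.prems \<open>Suc ?h = n\<close> by linarith
    qed
    note step = config_Suc_void[OF n True, unfolded if_P[OF this]]
    have h': "holder n adv (Suc ?t) = Suc ?h"
      unfolding holder_def[of _ _ "Suc ?t"] step by simp
    have old': "old (config n adv (Suc ?t) i) = old (config n adv ?t i)" for i
      unfolding step by simp
    have new': "new (config n adv (Suc ?t) i) = new (config n adv ?t i) @ arrivals adv ?t i" for i
      unfolding step by simp
    show ?thesis
      using count voids served new arr True new_count_Suc[of n adv ?t, OF new'] new_count
      by (auto simp del: config.simps
          simp: h' old' new' injections_Suc less_Suc_eq old_count_def)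
  next
    case False
    note step = config_Suc_heard[OF n False]
    have h': "holder n adv (Suc ?t) = ?h"
      unfolding holder_def[of _ _ "Suc ?t"] step by (simp add: token_config)
    have old': "old (config n adv (Suc ?t) i) =
      (if i = ?h then tl else id) (old (config n adv ?t i))" for i
      unfolding step by simp
    have new': "new (config n adv (Suc ?t) i) = new (config n adv ?t i) @ arrivals adv ?t i" for i
      unfolding step by simp
    have "old_count n adv ?t = Suc (old_count n adv (Suc ?t))"
    proof -
      have "old_count n adv (Suc ?t) = length (tl (old (config n adv ?t ?h)))
          + (\<Sum>i\<in>{..<n} - {?h}. length (old (config n adv ?t i)))"
        using h unfolding old_count_def by (subst sum.remove[of _ ?h]) (auto simp: old' simp del: config.simps)
      moreover have "old_count n adv ?t = length (old (config n adv ?t ?h))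
          + (\<Sum>i\<in>{..<n} - {?h}. length (old (config n adv ?t i)))"
        using h unfolding old_count_def by (subst sum.remove[of _ ?h]) auto
      ultimately show ?thesis using False by (cases "old (config n adv ?t ?h)") auto
    qed
    then show ?thesis
      using count voids served new arr new_count_Suc[of n adv ?t, OF new'] new_count
      by (auto simp del: config.simps simp: h' old' new' injections_Suc)
  qed
qed

lemma next_phase:
  assumes n: "n \<ge> 1" and s: "phase_start n adv s"
  defines "u \<equiv> s + n + old_count n adv s"
  shows "phase_start n adv u"
    and "old_count n adv u = injections n adv s u"
    and "i < n \<Longrightarrow> p \<in> set (queue (config n adv u i)) \<Longrightarrow> s \<le> inj_round p"
proof -
  define t where "t = s + (n + old_count n adv s - 1)"
  have u: "u = Suc t" using n by (simp add: u_def t_def)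
  have "n + old_count n adv s - 1 < n + old_count n adv s" using n by simp
  note inv = within_phase[OF n s this, folded t_def]
  let ?h = "holder n adv t"
  have h: "?h < n" using holder_less[OF n] .
  \<comment> \<open>With \<open>d = n + old_count n adv s - 1\<close> the counting identity reads
    \<open>n - 1 + old_count n adv t = ?h\<close>, while \<open>?h\<close> is at most
    \<open>n - 1\<close>.\<close>
  have last: "Suc ?h = n" and "old_count n adv t = 0"
    using inv h n by linarith+
  then have empty: "old (config n adv t i) = []" if "i < n" for i
    using that by (simp add: old_count_def)
  have "\<not> Suc ?h < n" using last by simp
  note step = config_Suc_void[OF n empty[OF h], unfolded if_not_P[OF this]]
  have old': "old (config n adv u i) = new (config n adv t i) @ arrivals adv t i" if "i < n" for i
    unfolding u step using empty that by simp
  have new': "new (config n adv u i) = []" for i unfolding u step by simp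
  show "phase_start n adv u"
    unfolding phase_start_def new' holder_def[of _ _ u] unfolding u step by simp
  have "old_count n adv u = (\<Sum>i<n. length (new (config n adv t i)) + adv t i)"
    unfolding old_count_def by (rule sum.cong) (auto simp: old' arrivals_def)
  then show "old_count n adv u = injections n adv s u"
    using inv by (simp add: u injections_Suc t_def sum.distrib new_count_def)
  show "s \<le> inj_round p" if "i < n" "p \<in> set (queue (config n adv u i))"
    using that inv by (auto simp: queue_def new' old' arrivals_def t_def)
qed

subsection \<open>The sequence of phases\<close>

lemma phase_start_phase: "n \<ge> 1 \<Longrightarrow> phase_start n adv (phase n adv k)"
  by (induction k) (simp_all add: next_phase(1) phase_start_def[of _ _ 0] holder_def)

lemma phase_of_round:
  assumes "n \<ge> 1"
  obtains k where "phase n adv k \<le> t" "t < phase n adv (Suc k)"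
proof -
  have "strict_mono (phase n adv)" using assms by (simp add: strict_mono_Suc_iff)
  then have "t < phase n adv (Suc t)"
    using strict_mono_imp_increasing[of "phase n adv" "Suc t"] by simp
  moreover have "\<exists>k. phase n adv k \<le> t \<and> t < phase n adv (Suc k)"
    if "t < phase n adv m" for m
    using that by (induction m) (auto simp del: phase.simps(2) intro: leI)
  ultimately show thesis using that by blast
qed

text \<open>The round \<open>t\<close> may lie beyond the end of phase \<open>k\<close>: the
  induction step applies the bound for phase \<open>k\<close> at a round \<open>t\<close> of phase
  \<open>k + 1\<close> or later.\<close>

lemma phase_invariant:
  assumes n: "n \<ge> 1" and \<rho>: "0 < \<rho>" "\<rho> < 1" and lb: "leaky_bucket n \<rho> \<beta> adv"
    and x: "x = \<rho> * (real n + x)" "0 \<le> x" and t: "phase n adv k \<le> t"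
  shows "real (old_count n adv (phase n adv k)) + real (injections n adv (phase n adv k) t)
    \<le> x + real \<beta> + \<rho> * real (t - phase n adv k)"
  using t
proof (induction k)
  case 0
  then show ?case using leaky_bucketD[OF lb, of 0 t] x(2) by (simp add: old_count_def)
next
  case (Suc k)
  let ?s = "phase n adv k" and ?u = "phase n adv (Suc k)"
  let ?O = "real (old_count n adv ?s)"
  have su: "?s \<le> ?u" and st: "?s \<le> t" using Suc.prems by auto
  have len: "real (t - ?s) = real (t - ?u) + real n + ?O"
    using Suc.prems by (simp add: of_nat_diff)
  have "old_count n adv ?u = injections n adv ?s ?u"
    using next_phase(2)[OF n phase_start_phase[OF n]] by simp
  \<comment> \<open>The packets old at \<open>?u\<close> are those injected since \<open>?s\<close>,
    so the quantity to bound is just the injections from \<open>?s\<close> to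
    \<open>t\<close>.\<close>
  then have inj: "real (old_count n adv ?u) + real (injections n adv ?u t)
      = real (injections n adv ?s t)"
    using injections_split[OF su Suc.prems, of n adv] by simp
  show ?case
  proof (cases "?O \<le> x")
    case True
    then have "\<rho> * (real n + ?O) \<le> x" using \<rho>(1) x(1) mult_left_mono[of "real n + ?O" "real n + x" \<rho>] by simp
    then show ?thesis
      unfolding inj using leaky_bucketD[OF lb st] by (simp add: len algebra_simps)
  next
    case False
    \<comment> \<open>Moving the origin from \<open>?s\<close> to \<open>?u\<close> adds at most
      \<open>\<rho> * (real n + ?O)\<close> injections and removes the \<open>?O\<close> packets
      heard; above the fixed point this is no gain.\<close>
    have "\<rho> * (real n + ?O) - ?O \<le> 0"
    proof -
      have "\<rho> * (?O - x) \<le> 1 * (?O - x)"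
        using \<rho> False by (intro mult_right_mono) auto
      then show ?thesis using x(1) by (simp add: algebra_simps)
    qed
    then show ?thesis
      unfolding inj using Suc.IH[OF st] by (simp add: len algebra_simps)
  qed
qed

lemma heard_within_next_phase:
  assumes n: "n \<ge> 1" and p: "p \<in> injected n adv"
    and r: "inj_round p < phase n adv (Suc k)"
  shows "\<exists>t \<ge> inj_round p. heard n adv t = Some p \<and> t < phase n adv (Suc (Suc k))"
proof -
  obtain i where i: "i < n" and arr: "p \<in> set (arrivals adv (inj_round p) i)"
    using p by (auto simp: injected_def arrivals_def)
  let ?u = "phase n adv (Suc (Suc k))" and ?r = "inj_round p"
  let ?in = "\<lambda>t. p \<in> set (queue (config n adv t i))"
  have "?in (Suc ?r)" using arrivals_subset_queue[OF n] arr by blast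
  \<comment> \<open>Whatever is queued at the end of phase \<open>k + 1\<close> was injected during
    that phase, hence later than \<open>p\<close>.\<close>
  moreover have "\<not> ?in ?u"
    using next_phase(3)[OF n phase_start_phase[OF n, of adv "Suc k"] i, of p] r by auto
  moreover have "Suc ?r \<le> ?u" using r by simp
  \<comment> \<open>A discrete intermediate value argument yields the round in which
    \<open>p\<close> leaves the queue.\<close>
  moreover have "\<exists>t \<ge> a. t < b \<and> ?in t \<and> \<not> ?in (Suc t)"
    if "?in a" "\<not> ?in b" "a \<le> b" for a b
    using that(3,1,2) by (induction b rule: dec_induct) (auto simp: less_Suc_eq simp del: config.simps)
  ultimately obtain t where "Suc ?r \<le> t" "t < ?u" "?in t" "\<not> ?in (Suc t)" by blast
  then show ?thesis using leaves_queue_imp_heard[OF n] by (intro exI[of _ t]) auto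
qed

theorem theorem1:
  fixes n \<beta> :: nat and \<rho> :: real and adv :: injection
  assumes "n \<ge> 1" and "0 < \<rho>" and "\<rho> < 1" and "\<beta> \<ge> 1"
    and "leaky_bucket n \<rho> \<beta> adv"
  shows "(\<forall>t. real (total_queued n adv t) \<le> 2 * \<rho> / (1 - \<rho>) * real n + real \<beta>)
       \<and> packet_latency_at_most n adv (2 / (1 - \<rho>) * real n + real \<beta> * (1 + \<rho>))"
proof -
  note n = assms(1)
  define x where "x = \<rho> * real n / (1 - \<rho>)"
  have x: "x = \<rho> * (real n + x)" and x0: "0 \<le> x"
    using assms by (simp_all add: x_def field_simps)
  note invariant = phase_invariant[OF n assms(2,3,5) x x0]
  have queued: "real (total_queued n adv t) \<le> 2 * \<rho> / (1 - \<rho>) * real n + real \<beta>" for t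
  proof -
    obtain k where k: "phase n adv k \<le> t" "t < phase n adv (Suc k)"
      by (rule phase_of_round[OF n])
    let ?s = "phase n adv k"
    define d where "d = t - ?s"
    have t: "t = ?s + d" and d: "d < n + old_count n adv ?s" using k by (auto simp: d_def)
    note within = within_phase[OF n phase_start_phase[OF n] d, folded t]
    have "holder n adv t < n" by (rule holder_less[OF n])
    have count: "real d + real (old_count n adv t)
        = real (old_count n adv ?s) + real (holder n adv t)"
      using within by (metis of_nat_add)
    \<comment> \<open>The difference \<open>d - holder n adv t\<close> counts the packets heard so
      far in the phase. Each such round lowers the bound on the queues by \<open>1 - \<rho>\<close>,
      so only the void rounds, fewer than \<open>n\<close>, can raise it.\<close>
    have "0 \<le> (1 - \<rho>) * (real d - real (holder n adv t))"
      using within assms(3) by simp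
    \<comment> \<open>Enlarging the right-hand side by \<open>\<rho> * x\<close> turns it into
      \<open>x\<close>, so that the final bound becomes \<open>2 * x + \<beta>\<close>.\<close>
    moreover have "\<rho> * real (holder n adv t) \<le> \<rho> * (real n + x)"
      using \<open>holder n adv t < n\<close> assms(2) x0 by (intro mult_left_mono) auto
    ultimately have void_rounds: "\<rho> * real (holder n adv t)
        - (1 - \<rho>) * (real d - real (holder n adv t)) \<le> \<rho> * (real n + x)"
      by linarith
    have "real (total_queued n adv t) = real (old_count n adv ?s) + real (injections n adv ?s t)
        - (real d - real (holder n adv t))"
      using within count by (simp add: total_queued_eq)
    also have "\<dots> \<le> x + real \<beta> + \<rho> * real d - (real d - real (holder n adv t))"
      using invariant[OF k(1)] by (simp add: d_def)
    also have "\<dots> = x + real \<beta> + \<rho> * real (holder n adv t)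
        - (1 - \<rho>) * (real d - real (holder n adv t))"
      by (simp add: algebra_simps)
    also have "\<dots> \<le> x + real \<beta> + \<rho> * (real n + x)"
      using void_rounds by linarith
    also have "\<dots> = 2 * \<rho> / (1 - \<rho>) * real n + real \<beta>"
      unfolding x[symmetric] by (simp add: x_def)
    finally show ?thesis .
  qed
  moreover have "\<exists>t \<ge> inj_round p. heard n adv t = Some p
      \<and> real (t - inj_round p + 1) \<le> 2 / (1 - \<rho>) * real n + real \<beta> * (1 + \<rho>)"
    if p: "p \<in> injected n adv" for p
  proof -
    obtain k where k: "phase n adv k \<le> inj_round p" "inj_round p < phase n adv (Suc k)"
      by (rule phase_of_round[OF n])
    obtain t where t: "t \<ge> inj_round p" "heard n adv t = Some p" "t < phase n adv (Suc (Suc k))"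
      using heard_within_next_phase[OF n p k(2)] by blast
    let ?s = "phase n adv k" and ?u = "phase n adv (Suc k)"
    let ?O = "real (old_count n adv ?s)"
    have "old_count n adv ?u = injections n adv ?s ?u"
      using next_phase(2)[OF n phase_start_phase[OF n]] by simp
    \<comment> \<open>The invariant at the last admissible moment of phase \<open>k\<close>, namely
      \<open>t = ?u\<close>, where \<open>?u - ?s = n + ?O\<close>; the next line takes it at
      \<open>t = ?s\<close>.\<close>
    then have both: "?O + real (old_count n adv ?u) \<le> x + real \<beta> + \<rho> * (real n + ?O)"
      using invariant[of k ?u] by (simp add: algebra_simps)
    have "?O \<le> x + real \<beta>" using invariant[of k ?s] by (simp add: injections_def)
    then have "\<rho> * (real n + ?O) \<le> \<rho> * (real n + x + real \<beta>)"
      using assms by simp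
    also have "\<dots> = x + \<rho> * real \<beta>" using x by (simp add: algebra_simps)
    finally have both': "?O + real (old_count n adv ?u) \<le> 2 * x + real \<beta> * (1 + \<rho>)"
      using both by (simp add: algebra_simps)
    \<comment> \<open>The rounds from injection to hearing all lie within phases \<open>k\<close>
      and \<open>k + 1\<close>, whose lengths add up to the right-hand side.\<close>
    have "t - inj_round p + 1 \<le> 2 * n + old_count n adv ?s + old_count n adv ?u"
      using t k by simp
    then have "real (t - inj_round p + 1) \<le> 2 * real n + ?O + real (old_count n adv ?u)"
      using of_nat_mono by fastforce
    also have "\<dots> \<le> 2 * (real n + x) + real \<beta> * (1 + \<rho>)" using both' by simp
    also have "real n + x = real n / (1 - \<rho>)" using assms by (simp add: x_def field_simps)
    finally show ?thesis using t by auto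
  qed
  ultimately show ?thesis unfolding packet_latency_at_most_def by blast
qed

end
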